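(* Let $M \subset \mathbb{R}^n$ be a submanifold and let $\xi \in \Gamma(\nu(M))$ be a normal vector field of constant length, i.e. $\|\xi\|$ is constant on $M$. If the submanifolds $M_{t\xi} := M + t\xi \subset \mathbb{R}^n$ are minimal submanifolds for all small values of $t$ (i.e. for all $t$ in some interval around $0$), then $\xi$ is constant in $\mathbb{R}^n$, i.e. $\xi$ is parallel with respect to the normal connection and $A_{\xi} \equiv 0$, where $A_{\xi}$ is the shape operator of $M$ in direction $\xi$.
   Context: $\nu(M)$ is the normal bundle of $M$. $M_{t\xi}=M+t\xi$ is the (immersed) submanifold given by the map $p\mapsto p+t\xi(p)$, $p\in M$. With $D$ the directional derivative of $\mathbb{R}^n$, the shape operator is $A_\xi(X)=-(D_X\xi)^{\top}$ and the normal connection is $\nabla^\perp_X\xi=(D_X\xi)^{\perp}$; "constant in $\mathbb{R}^n$" means $D_X\xi=0$ for all $X$ tangent to $M$. A submanifold is minimal if its mean curvature vector vanishes. *)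

theory Defs
  imports "HOL-Analysis.Analysis"
begin

section \<open>Smooth maps between open subsets of normed spaces\<close>

text \<open>All directional derivatives up to order \<open>k\<close> exist and are continuous. For maps on an open
  subset of a finite-dimensional space this is the usual class \<open>C\<^sup>k\<close>.\<close>

primrec ck_on :: "nat \<Rightarrow> 'b::real_normed_vector set \<Rightarrow> ('b \<Rightarrow> 'c::real_normed_vector) \<Rightarrow> bool" where
  "ck_on 0 U f \<longleftrightarrow> continuous_on U f"
| "ck_on (Suc k) U f \<longleftrightarrow> (\<forall>x\<in>U. f differentiable (at x)) \<and>
     (\<forall>v. ck_on k U (\<lambda>x. frechet_derivative f (at x) v))"

definition smooth_on :: "'b::real_normed_vector set \<Rightarrow> ('b \<Rightarrow> 'c::real_normed_vector) \<Rightarrow> bool" where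
  "smooth_on U f \<longleftrightarrow> (\<forall>k. ck_on k U f)"

definition immersion_on :: "'b::real_normed_vector set \<Rightarrow> ('b \<Rightarrow> 'c::real_normed_vector) \<Rightarrow> bool" where
  "immersion_on U F \<longleftrightarrow> smooth_on U F \<and> (\<forall>x\<in>U. inj (frechet_derivative F (at x)))"

section \<open>Submanifolds\<close>

text \<open>A submanifold of \<open>\<real>\<^sup>n\<close> is a subset \<open>M\<close> together with a smooth atlas for which the inclusion is an
  immersion. The atlas \<open>\<A>\<close> is given by its local parametrizations \<open>(U, \<phi>)\<close>, that is, by the
  inverses of charts, with \<open>U\<close> open in the model space \<open>'b\<close>; the topology of \<open>M\<close> is the one
  defined by \<open>\<A>\<close>. It is allowed to be finer than the subspace topology (it is Hausdorff, because
  the inclusion is continuous and injective). Embedded submanifolds are the case in which each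
  \<open>\<phi> ` U\<close> is open in the subspace \<open>M\<close> and each \<open>\<phi>\<close> is a homeomorphism onto it.

  The injectivity of the differentials forces \<open>'b\<close> to be finite-dimensional with dimension
  \<open>dim M\<close>. The class \<open>euclidean_space\<close> is avoided only because it excludes \<open>dim M = 0\<close>.\<close>

definition is_submanifold ::
    "(real^'n) set \<Rightarrow> ('b::real_normed_vector set \<times> ('b \<Rightarrow> real^'n)) set \<Rightarrow> bool" where
  "is_submanifold M \<A> \<longleftrightarrow>
     (\<Union>(U, \<phi>)\<in>\<A>. \<phi> ` U) = M \<and>
     (\<exists>\<B>\<subseteq>\<A>. countable \<B> \<and> (\<Union>(U, \<phi>)\<in>\<B>. \<phi> ` U) = M) \<and>
     (\<forall>(U, \<phi>)\<in>\<A>. open U \<and> inj_on \<phi> U \<and> immersion_on U \<phi>) \<and>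
     (\<forall>(U, \<phi>)\<in>\<A>. \<forall>(V, \<psi>)\<in>\<A>.
        open {x\<in>U. \<phi> x \<in> \<psi> ` V} \<and>
        smooth_on {x\<in>U. \<phi> x \<in> \<psi> ` V} (inv_into V \<psi> \<circ> \<phi>))"

definition smooth_map ::
    "('b::real_normed_vector set \<times> ('b \<Rightarrow> real^'n)) set \<Rightarrow> (real^'n \<Rightarrow> real^'n) \<Rightarrow> bool" where
  "smooth_map \<A> f \<longleftrightarrow> (\<forall>(U, \<phi>)\<in>\<A>. smooth_on U (f \<circ> \<phi>))"

definition tangent_space ::
    "('b::real_normed_vector set \<times> ('b \<Rightarrow> real^'n)) set \<Rightarrow> real^'n \<Rightarrow> (real^'n) set" where
  "tangent_space \<A> p =
     {X. \<exists>(U, \<phi>)\<in>\<A>. \<exists>x\<in>U. \<phi> x = p \<and> X \<in> range (frechet_derivative \<phi> (at x))}"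

text \<open>The derivative \<open>D\<^sub>X \<eta>\<close> at \<open>p\<close> of a smooth map \<open>\<eta>\<close> on \<open>M\<close> in the direction of the tangent vector
  \<open>X\<close>. Since \<open>\<eta>\<close> is defined only on \<open>M\<close>, it is computed in a parametrization, with
  \<open>X = d\<phi>\<^sub>x v\<close>; by the chain rule the result does not depend on the parametrization.\<close>

definition dir_deriv ::
    "('b::real_normed_vector set \<times> ('b \<Rightarrow> real^'n)) set \<Rightarrow> (real^'n \<Rightarrow> real^'n) \<Rightarrow>
     real^'n \<Rightarrow> real^'n \<Rightarrow> real^'n" where
  "dir_deriv \<A> \<eta> p X =
     (THE d. \<exists>(U, \<phi>)\<in>\<A>. \<exists>x\<in>U. \<exists>v. \<phi> x = p \<and> frechet_derivative \<phi> (at x) v = X \<and>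
        d = frechet_derivative (\<eta> \<circ> \<phi>) (at x) v)"

section \<open>Normal fields, shape operator and normal connection\<close>

definition tangential_part :: "(real^'n) set \<Rightarrow> real^'n \<Rightarrow> real^'n" where
  "tangential_part T w = (THE y. y \<in> T \<and> (\<forall>z\<in>T. orthogonal (w - y) z))"

definition normal_part :: "(real^'n) set \<Rightarrow> real^'n \<Rightarrow> real^'n" where
  "normal_part T w = w - tangential_part T w"

definition normal_field ::
    "(real^'n) set \<Rightarrow> ('b::real_normed_vector set \<times> ('b \<Rightarrow> real^'n)) set \<Rightarrow>
     (real^'n \<Rightarrow> real^'n) \<Rightarrow> bool" where
  "normal_field M \<A> \<xi> \<longleftrightarrow>
     smooth_map \<A> \<xi> \<and> (\<forall>p\<in>M. \<forall>X\<in>tangent_space \<A> p. orthogonal (\<xi> p) X)"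

definition shape_operator ::
    "('b::real_normed_vector set \<times> ('b \<Rightarrow> real^'n)) set \<Rightarrow> (real^'n \<Rightarrow> real^'n) \<Rightarrow>
     real^'n \<Rightarrow> real^'n \<Rightarrow> real^'n" where
  "shape_operator \<A> \<xi> p X = - tangential_part (tangent_space \<A> p) (dir_deriv \<A> \<xi> p X)"

definition normal_connection ::
    "('b::real_normed_vector set \<times> ('b \<Rightarrow> real^'n)) set \<Rightarrow> (real^'n \<Rightarrow> real^'n) \<Rightarrow>
     real^'n \<Rightarrow> real^'n \<Rightarrow> real^'n" where
  "normal_connection \<A> \<xi> p X = normal_part (tangent_space \<A> p) (dir_deriv \<A> \<xi> p X)"

section \<open>Minimal immersed submanifolds\<close>

text \<open>For a parametrized immersion \<open>F\<close> the second fundamental form is \<open>\<alpha>(X, Y) = (D\<^sub>X Y)\<^sup>\<bottom>\<close>.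
  Taking \<open>X = dF v\<close> and extending \<open>Y = dF w\<close> to a tangent field with constant \<open>w\<close>, we get the normal
  part of the second derivative of \<open>F\<close>. Arguments are given by the coordinate vectors \<open>v\<close>, \<open>w\<close>.\<close>

definition second_fundamental_form ::
    "('b::real_normed_vector \<Rightarrow> real^'n) \<Rightarrow> 'b \<Rightarrow> 'b \<Rightarrow> 'b \<Rightarrow> real^'n" where
  "second_fundamental_form F x v w =
     normal_part (range (frechet_derivative F (at x)))
       (frechet_derivative (\<lambda>y. frechet_derivative F (at y) w) (at x) v)"

definition orthonormal_basis_of :: "(real^'n) set \<Rightarrow> (real^'n) set \<Rightarrow> bool" where
  "orthonormal_basis_of T B \<longleftrightarrow> pairwise orthogonal B \<and> (\<forall>b\<in>B. norm b = 1) \<and> span B = T"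

text \<open>The mean curvature vector is the trace of the second fundamental form with respect to the induced
  metric (not divided by the dimension, which is immaterial for minimality). The trace does
  not depend on the orthonormal basis of the tangent space.\<close>

definition mean_curvature :: "('b::real_normed_vector \<Rightarrow> real^'n) \<Rightarrow> 'b \<Rightarrow> real^'n" where
  "mean_curvature F x =
     (let dF = frechet_derivative F (at x); B = (SOME B. orthonormal_basis_of (range dF) B)
      in \<Sum>b\<in>B. second_fundamental_form F x (inv dF b) (inv dF b))"

text \<open>The immersed submanifold given by a map \<open>f\<close> on \<open>M\<close>: being an immersion is part of the notion,
  injectivity of \<open>f\<close> is not.\<close>

definition minimal_immersed_submanifold ::
    "('b::real_normed_vector set \<times> ('b \<Rightarrow> real^'n)) set \<Rightarrow> (real^'n \<Rightarrow> real^'n) \<Rightarrow> bool" where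
  "minimal_immersed_submanifold \<A> f \<longleftrightarrow>
     (\<forall>(U, \<phi>)\<in>\<A>. immersion_on U (f \<circ> \<phi>) \<and> (\<forall>x\<in>U. mean_curvature (f \<circ> \<phi>) x = 0))"

end

theory Submission
  imports Defs
begin

text \<open>Differentiating \<open>\<xi> \<bullet> \<xi>\<close> and \<open>\<xi> \<bullet> dF\<^sub>t\<close>, with \<open>F\<^sub>t = \<phi> + t\<xi>\<close>, shows that \<open>\<xi>\<close> is normal to every \<open>M\<^sub>t\<^sub>\<xi>\<close>,
  with second fundamental form \<open>-d\<xi> \<bullet> dF\<^sub>t\<close> in the direction \<open>\<xi>\<close>, which is minus half the
  \<open>t\<close>-derivative of the induced metric \<open>g\<^sub>t = 1 + 2tH + t\<^sup>2K\<close>. Here \<open>H\<close> is the tangential part of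
  \<open>d\<xi>\<close> and \<open>K = d\<xi>\<^sup>T d\<xi> \<ge> H\<^sup>2\<close>. Minimality thus means that \<open>det g\<^sub>t\<close> has derivative \<open>0\<close> for small \<open>t\<close>.
  Being a polynomial in \<open>t\<close>, it equals \<open>1\<close> for all \<open>t\<close>. But \<open>g\<^sub>t \<ge> (1 + tH)\<^sup>2 \<ge> 1\<close> for large \<open>t\<close>, because
  the eigenvalues of \<open>H\<close> that are not zero are bounded away from zero. So \<open>g\<^sub>t = 1\<close> for large \<open>t\<close>,
  hence \<open>K = 0\<close> and \<open>d\<xi> = 0\<close>.\<close>

section \<open>Derivatives of determinants\<close>

text \<open>Termwise product rule in the Leibniz expansion: the terms that differentiate the factor
  from row \<open>k\<close> add up to the determinant whose \<open>k\<close>-th row is replaced by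
  that of \<open>G'\<close>.\<close>

lemma has_field_derivative_det:
  fixes G :: "'a::real_normed_field \<Rightarrow> 'a^'n^'n"
  assumes "\<And>i j. ((\<lambda>s. G s $ i $ j) has_field_derivative G' $ i $ j) (at t)"
  shows "((\<lambda>s. det (G s)) has_field_derivative
           (\<Sum>k\<in>UNIV. det (\<chi> i. if i = k then row k G' else row i (G t)))) (at t)"
proof -
  have "((\<lambda>s. det (G s)) has_field_derivative
          (\<Sum>p | p permutes UNIV. of_int (sign p) *
             (\<Sum>k\<in>UNIV. G' $ k $ p k * (\<Prod>i\<in>UNIV - {k}. G t $ i $ p i)))) (at t)"
    unfolding det_def
    by (intro DERIV_sum DERIV_cmult has_field_derivative_prod assms)
  also have "(\<Sum>p | p permutes UNIV. of_int (sign p) *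
             (\<Sum>k\<in>UNIV. G' $ k $ p k * (\<Prod>i\<in>UNIV - {k}. G t $ i $ p i)))
      = (\<Sum>k\<in>UNIV. \<Sum>p | p permutes UNIV. of_int (sign p) *
             (G' $ k $ p k * (\<Prod>i\<in>UNIV - {k}. G t $ i $ p i)))"
    by (subst sum.swap) (simp add: sum_distrib_left)
  also have "\<dots> = (\<Sum>k\<in>UNIV. det (\<chi> i. if i = k then row k G' else row i (G t)))"
    unfolding det_def
  proof (intro sum.cong refl arg_cong2[where f = "(*)"])
    fix k :: 'n and p :: "'n \<Rightarrow> 'n"
    show "G' $ k $ p k * (\<Prod>i\<in>UNIV - {k}. G t $ i $ p i)
        = (\<Prod>i\<in>UNIV. (\<chi> i. if i = k then row k G' else row i (G t)) $ i $ p i)"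
      by (subst prod.remove[of UNIV k]) (auto simp: row_def intro!: prod.cong)
  qed
  finally show ?thesis .
qed

text \<open>Since \<open>G' = (G' ** R) ** G t\<close>, row \<open>k\<close> of \<open>G'\<close> is
  a combination of the rows of \<open>G t\<close> with coefficients from row \<open>k\<close> of
  \<open>G' ** R\<close>. Cramer's rule turns the \<open>k\<close>-th summand of the previous
  derivative into the \<open>k\<close>-th diagonal entry of \<open>G' ** R\<close> times
  \<open>det (G t)\<close>.\<close>

lemma jacobi_formula:
  fixes G :: "'a::real_normed_field \<Rightarrow> 'a^'n^'n"
  assumes "\<And>i j. ((\<lambda>s. G s $ i $ j) has_field_derivative G' $ i $ j) (at t)"
    and R: "R ** G t = mat 1"
  shows "((\<lambda>s. det (G s)) has_field_derivative trace (R ** G') * det (G t)) (at t)"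
proof -
  have G': "G' = (G' ** R) ** G t"
    by (simp add: matrix_mul_assoc[symmetric] R)
  have "det (\<chi> i. if i = k then row k G' else row i (G t)) = (G' ** R) $ k $ k * det (G t)" for k
  proof -
    have "row k G' = (\<Sum>i\<in>UNIV. ((G' ** R) $ k) $ i *s row i (G t))"
      by (subst G') (simp add: vec_eq_iff row_def matrix_matrix_mult_def)
    then show ?thesis
      by (simp only: cramer_lemma_transpose)
  qed
  then show ?thesis
    using has_field_derivative_det[OF assms(1)]
    unfolding trace_mul_sym[of R G'] by (simp add: trace_def sum_distrib_right)
qed

section \<open>Symmetric matrices and quadratic pencils\<close>

lemma trace_eq_sum_inner:
  fixes A :: "real^'n^'n"
  shows "trace A = (\<Sum>i\<in>UNIV. axis i 1 \<bullet> (A *v axis i 1))"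
  by (simp add: trace_def inner_axis' matrix_vector_mult_basis column_def)

lemma symmetric_matrix_inner:
  fixes S :: "real^'n^'n"
  assumes "transpose S = S"
  shows "(S *v x) \<bullet> y = x \<bullet> (S *v y)"
  by (metis assms dot_lmul_matrix inner_commute transpose_matrix_vector)

lemma matrix_left_inverse_exists:
  fixes A :: "real^'n^'n"
  assumes "\<And>x. A *v x = 0 \<Longrightarrow> x = 0"
  obtains R where "R ** A = mat 1"
  using assms matrix_left_invertible_ker by blast

lemma matrix_vector_add_scaleR:
  fixes A B :: "real^'n^'m"
  shows "(A + c *\<^sub>R B) *v x = A *v x + c *\<^sub>R (B *v x)"
  by (simp add: matrix_vector_mult_add_rdistrib scaleR_matrix_vector_assoc)

text \<open>Along \<open>mat 1 + s *\<^sub>R S\<close> the determinant is nondecreasing for s \<ge>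
  0, by Jacobi's formula. Equal values at s = 0 and s = 1 force its derivative at 0, the trace of
  \<open>S\<close>, to vanish; a positive semidefinite matrix of trace 0 is 0.\<close>

lemma psd_det_one_imp_zero:
  fixes S :: "real^'n^'n"
  assumes sym: "transpose S = S"
    and psd: "\<And>x. 0 \<le> x \<bullet> (S *v x)"
    and det1: "det (mat 1 + S) = 1"
  shows "S = 0"
proof -
  define G where "G s = mat 1 + s *\<^sub>R S" for s :: real
  have Gv: "G s *v x = x + s *\<^sub>R (S *v x)" for s x
    by (simp add: G_def matrix_vector_add_scaleR)
  have symG: "transpose (G s) = G s" for s
    using sym by (simp add: G_def transpose_def vec_eq_iff mat_def)
  have inj: "x = 0" if "s \<ge> 0" "G s *v x = 0" for s x
  proof -
    have "x \<bullet> (G s *v x) = x \<bullet> x + s * (x \<bullet> (S *v x))"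
      by (simp add: Gv inner_right_distrib)
    then have "x \<bullet> x \<le> 0" using that psd[of x]
      by (smt (verit) inner_zero_right mult_nonneg_nonneg)
    then show ?thesis by (metis inner_ge_zero inner_eq_zero_iff order_antisym)
  qed
  have "\<forall>s\<in>{0..}. \<exists>R. R ** G s = mat 1"
    using inj matrix_left_inverse_exists by (metis atLeast_iff)
  then obtain R where R: "\<And>s. s \<ge> 0 \<Longrightarrow> R s ** G s = mat 1"
    unfolding bchoice_iff by auto
  have deriv: "((\<lambda>s. det (G s)) has_field_derivative trace (R s ** S) * det (G s)) (at s)"
    if "s \<ge> 0" for s
    by (rule jacobi_formula[where G = G, OF _ R[OF that]])
       (auto simp: G_def intro!: derivative_eq_intros)
  have tr: "trace (R s ** S) = (\<Sum>i\<in>UNIV. (R s *v axis i 1) \<bullet> (S *v (R s *v axis i 1)) +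
         s * ((S *v (R s *v axis i 1)) \<bullet> (S *v (R s *v axis i 1))))" if "s \<ge> 0" for s
  proof -
    have GR: "G s ** R s = mat 1" by (rule matrix_left_right_inverse[THEN iffD1, OF R[OF that]])
    have symR: "transpose (R s) = R s"
    proof -
      have "transpose (R s) ** G s = mat 1"
        by (metis GR matrix_transpose_mul symG transpose_mat)
      then show ?thesis
        by (metis GR matrix_mul_assoc matrix_mul_lid matrix_mul_rid)
    qed
    have "axis i 1 \<bullet> ((R s ** S) *v axis i 1) = (R s *v axis i 1) \<bullet> (S *v (R s *v axis i 1)) +
         s * ((S *v (R s *v axis i 1)) \<bullet> (S *v (R s *v axis i 1)))" for i
    proof -
      \<comment> \<open>Writing the basis vector as \<open>G s\<close> applied to \<open>y\<close>
        expresses the diagonal entry through \<open>y\<close> alone, as y . Sy + s |Sy|^2, which is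
        visibly nonnegative.\<close>
      define y where "y = R s *v axis i 1"
      have a: "axis i 1 = y + s *\<^sub>R (S *v y)"
        by (metis GR Gv matrix_vector_mul_assoc matrix_vector_mul_lid y_def)
      have "axis i 1 \<bullet> ((R s ** S) *v axis i 1) = y \<bullet> (S *v axis i 1)"
        by (simp add: y_def matrix_vector_mul_assoc[symmetric] symmetric_matrix_inner[OF symR])
      also have "\<dots> = (S *v y) \<bullet> axis i 1"
        by (simp add: symmetric_matrix_inner[OF sym])
      also have "\<dots> = y \<bullet> (S *v y) + s * ((S *v y) \<bullet> (S *v y))"
        by (simp add: a inner_right_distrib inner_commute)
      finally show ?thesis by (simp add: y_def)
    qed
    then show ?thesis by (simp add: trace_eq_sum_inner)
  qed
  have tr_nonneg: "trace (R s ** S) \<ge> 0" if "s \<ge> 0" for s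
    using that psd by (auto simp: tr intro!: sum_nonneg add_nonneg_nonneg)
  have det_nz: "det (G s) \<noteq> 0" if "s \<ge> 0" for s
    using R[OF that] by (metis det_I det_mul mult_zero_right zero_neq_one)
  have cont: "continuous_on {0..} (\<lambda>s. det (G s))"
    using deriv by (auto intro!: continuous_at_imp_continuous_on DERIV_isCont)
  have det_pos: "det (G s) > 0" if "s \<ge> 0" for s
  proof (rule ccontr)
    assume "\<not> det (G s) > 0"
    then have "det (G s) \<le> 0" by simp
    moreover have "det (G 0) = 1" by (simp add: G_def)
    moreover have "continuous_on {0..s} (\<lambda>s. det (G s))"
      using cont continuous_on_subset by fastforce
    ultimately obtain u where "0 \<le> u" "det (G u) = 0"
      using IVT2'[of "\<lambda>s. det (G s)" s 0 0] \<open>s \<ge> 0\<close> by auto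
    then show False using det_nz by blast
  qed
  have mono: "det (G a) \<le> det (G b)" if "0 \<le> a" "a \<le> b" for a b
  proof (rule DERIV_nonneg_imp_nondecreasing[OF that(2)])
    fix s assume "a \<le> s"
    with that have s: "s \<ge> 0" by simp
    then have "0 \<le> trace (R s ** S) * det (G s)"
      by (intro mult_nonneg_nonneg tr_nonneg less_imp_le[OF det_pos])
    with deriv[OF s] show "\<exists>y. ((\<lambda>s. det (G s)) has_real_derivative y) (at s) \<and> 0 \<le> y"
      by blast
  qed
  have tr0: "trace S = 0"
  proof (rule ccontr)
    assume "trace S \<noteq> 0"
    have R0: "R 0 = mat 1" using R[of 0] by (simp add: G_def)
    then have "trace S > 0" using tr_nonneg[of 0] \<open>trace S \<noteq> 0\<close> by simp
    moreover have "((\<lambda>s. det (G s)) has_field_derivative trace S) (at 0)"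
      using deriv[of 0] R0 by (simp add: G_def)
    ultimately obtain d where d: "d > 0" "\<And>h. 0 < h \<Longrightarrow> h < d \<Longrightarrow> det (G 0) < det (G (0 + h))"
      using DERIV_pos_inc_right by blast
    \<comment> \<open>Small enough for the strict increase right of 0, and at most 1, so that
      monotonicity carries the strict inequality on to \<open>G 1\<close>.\<close>
    define h where "h = min (d/2) 1"
    have h: "0 < h" "h < d" "h \<le> 1" using d(1) by (auto simp: h_def)
    have "det (G 0) < det (G h)" using d(2)[of h] h by simp
    moreover have "det (G h) \<le> det (G 1)" using h by (intro mono) auto
    ultimately show False using det1 by (simp add: G_def)
  qed
  have "axis i 1 \<bullet> (S *v axis i 1) = 0" for i
    using tr0 psd unfolding trace_eq_sum_inner
    by (subst (asm) sum_nonneg_eq_0_iff) auto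
  then have diag: "S $ i $ i = 0" for i
    by (simp add: inner_axis' matrix_vector_mult_basis column_def)
  have offdiag: "S $ i $ j = 0" for i j
  proof (cases "i = j")
    case False
    have Sij: "S $ j $ i = S $ i $ j" for i j
      using arg_cong[OF sym, of "\<lambda>A. A $ i $ j"] by (simp add: transpose_def)
    \<comment> \<open>With zero diagonal the quadratic form on this vector is linear in
      \<open>c\<close>; nonnegativity for c = 1 and c = -1 kills the coefficient.\<close>
    have "(axis i 1 + c *\<^sub>R axis j 1) \<bullet> (S *v (axis i 1 + c *\<^sub>R axis j 1)) = 2 * c * S $ i $ j" for c
      by (simp add: matrix_vector_right_distrib matrix_vector_mult_scaleR inner_left_distrib
          inner_right_distrib inner_axis' matrix_vector_mult_basis column_def diag Sij[of i j])
    then have "0 \<le> 2 * c * S $ i $ j" for c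
      by (metis psd)
    from this[of 1] this[of "-1"] show ?thesis by simp
  qed (simp add: diag)
  then show ?thesis by (simp add: vec_eq_iff)
qed

text \<open>The pencil plays the role of the induced metrics, and the trace in \<open>tr\<close> is
  half the logarithmic derivative of its determinant. The determinant is thus 1 near 0, hence for
  all t as a polynomial. Assumption \<open>ge\<close>, that is K \<ge> H^2, makes the pencil minus
  the identity positive semidefinite for large t, where the preceding lemma applies.\<close>

lemma quadratic_pencil_trace_zero:
  fixes H K :: "real^'n^'n"
  assumes symH: "transpose H = H" and symK: "transpose K = K"
    and ge: "\<And>z. (H *v z) \<bullet> (H *v z) \<le> z \<bullet> (K *v z)"
    and "\<epsilon> > 0"
    and inj: "\<And>t z. \<bar>t\<bar> < \<epsilon> \<Longrightarrow> (mat 1 + (2*t) *\<^sub>R H + t\<^sup>2 *\<^sub>R K) *v z = 0 \<Longrightarrow> z = 0"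
    and tr: "\<And>t R. \<bar>t\<bar> < \<epsilon> \<Longrightarrow> R ** (mat 1 + (2*t) *\<^sub>R H + t\<^sup>2 *\<^sub>R K) = mat 1 \<Longrightarrow>
                trace (R ** (H + t *\<^sub>R K)) = 0"
  shows "K = 0"
proof -
  define G where "G t = mat 1 + (2*t) *\<^sub>R H + t\<^sup>2 *\<^sub>R K" for t :: real
  have deriv0: "((\<lambda>t. det (G t)) has_field_derivative 0) (at t)" if t: "\<bar>t\<bar> < \<epsilon>" for t
  proof -
    obtain R where R: "R ** G t = mat 1"
      using matrix_left_inverse_exists inj[OF t] unfolding G_def by blast
    have "((\<lambda>t. det (G t)) has_field_derivative trace (R ** (2 *\<^sub>R (H + t *\<^sub>R K))) * det (G t)) (at t)"
      by (rule jacobi_formula[where G = G, OF _ R])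
         (auto simp: G_def algebra_simps intro!: derivative_eq_intros)
    moreover have "trace (R ** (2 *\<^sub>R (H + t *\<^sub>R K))) = 2 * trace (R ** (H + t *\<^sub>R K))"
      by (simp add: trace_def matrix_matrix_mult_def sum_distrib_left algebra_simps)
    ultimately show ?thesis using tr[OF t] R by (simp add: G_def)
  qed
  have const: "det (G t) = 1" if t: "\<bar>t\<bar> < \<epsilon>" for t
  proof -
    have "det (G t) = det (G 0)"
      using has_field_derivative_zero_constant[of "{-\<epsilon><..<\<epsilon>}" "\<lambda>t. det (G t)"] deriv0 t \<open>\<epsilon> > 0\<close>
      by (smt (verit) convex_real_interval(8) greaterThanLessThan_iff has_field_derivative_at_within)
    then show ?thesis by (simp add: G_def)
  qed
  \<comment> \<open>The Leibniz formula over polynomials in t: each list holds the coefficients of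
    1, t and t^2 in an entry of \<open>G t\<close>.\<close>
  define q :: "real poly" where "q = (\<Sum>p | p permutes (UNIV::'n set). of_int (sign p) *
      (\<Prod>i\<in>UNIV. [: mat 1 $ i $ p i, 2 * H $ i $ p i, K $ i $ p i :]))"
  have q: "poly q t = det (G t)" for t
    by (simp add: q_def det_def poly_sum poly_prod G_def algebra_simps power2_eq_square
         of_int_poly)
  have "q - 1 = 0"
  proof (rule ccontr)
    assume "q - 1 \<noteq> 0"
    then have "finite {t. poly (q - 1) t = 0}" by (rule poly_roots_finite)
    moreover have "{-\<epsilon><..<\<epsilon>} \<subseteq> {t. poly (q - 1) t = 0}"
      using const by (auto simp: q)
    ultimately have "finite {-\<epsilon><..<\<epsilon>}" by (rule rev_finite_subset)
    then show False using \<open>\<epsilon> > 0\<close> infinite_Ioo[of "-\<epsilon>" \<epsilon>] by simp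
  qed
  then have det1: "det (G t) = 1" for t
    using q[of t] by simp
  \<comment> \<open>A bound on a linear right inverse \<open>g\<close> of \<open>H\<close> on its
    range; it stands in for the reciprocal of the least nonzero absolute eigenvalue. By symmetry of
    \<open>H\<close>, z . Hz = Hz . g(Hz).\<close>
  obtain C where C: "C > 0" "\<And>z. \<bar>z \<bullet> (H *v z)\<bar> \<le> C * ((H *v z) \<bullet> (H *v z))"
  proof -
    obtain g where g: "linear g" "\<And>v. v \<in> range ((*v) H) \<Longrightarrow> H *v (g v) = v"
      using linear_exists_right_inverse_on[OF matrix_vector_mul_linear subspace_UNIV, of H] by blast
    obtain C where C: "C > 0" "\<And>x. norm (g x) \<le> C * norm x"
      using linear_bounded_pos[OF g(1)] by blast
    have "\<bar>z \<bullet> (H *v z)\<bar> \<le> C * ((H *v z) \<bullet> (H *v z))" for z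
    proof -
      have "z \<bullet> (H *v z) = z \<bullet> (H *v g (H *v z))" using g(2) by simp
      also have "\<dots> = (H *v z) \<bullet> g (H *v z)" by (simp add: symmetric_matrix_inner[OF symH])
      finally have "\<bar>z \<bullet> (H *v z)\<bar> \<le> norm (H *v z) * norm (g (H *v z))"
        by (simp add: Cauchy_Schwarz_ineq2)
      also have "\<dots> \<le> norm (H *v z) * (C * norm (H *v z))"
        by (intro mult_left_mono C) auto
      finally show ?thesis by (simp add: dot_square_norm power2_eq_square algebra_simps)
    qed
    with C(1) show thesis using that by blast
  qed
  \<comment> \<open>The threshold comes from 2t (z . Hz) + t^2 (z . Kz) \<ge> t (t - 2C)
    |Hz|^2.\<close>
  have zero: "(2*t) *\<^sub>R H + t\<^sup>2 *\<^sub>R K = 0" if t: "t \<ge> 2 * C" for t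
  proof (rule psd_det_one_imp_zero)
    show "transpose ((2*t) *\<^sub>R H + t\<^sup>2 *\<^sub>R K) = (2*t) *\<^sub>R H + t\<^sup>2 *\<^sub>R K"
      using symH symK by (simp add: transpose_def vec_eq_iff)
    show "det (mat 1 + ((2*t) *\<^sub>R H + t\<^sup>2 *\<^sub>R K)) = 1"
      using det1[of t] by (simp add: G_def add.assoc)
    fix z
    let ?h = "(H *v z) \<bullet> (H *v z)"
    have t0: "t \<ge> 0" using t C(1) by simp
    have "(2 * C) * (t * ?h) \<le> t * (t * ?h)"
      by (rule mult_right_mono[OF t]) (simp add: t0)
    moreover have "(2 * t) * (- (C * ?h)) \<le> (2 * t) * (z \<bullet> (H *v z))"
      by (rule mult_left_mono) (use C(2)[of z] t0 in auto)
    moreover have "t\<^sup>2 * (z \<bullet> (K *v z)) \<ge> t\<^sup>2 * ?h"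
      by (intro mult_left_mono ge) auto
    ultimately have "0 \<le> 2 * t * (z \<bullet> (H *v z)) + t\<^sup>2 * (z \<bullet> (K *v z))"
      by (simp add: power2_eq_square mult.assoc mult.left_commute[of t C])
    then show "0 \<le> z \<bullet> (((2*t) *\<^sub>R H + t\<^sup>2 *\<^sub>R K) *v z)"
      by (simp add: matrix_vector_add_scaleR scaleR_matrix_vector_assoc[symmetric]
          inner_right_distrib)
  qed
  have "K $ i $ j = 0" for i j
  proof -
    have "2 * t * H $ i $ j + t\<^sup>2 * K $ i $ j = 0" if "t \<ge> 2 * C" for t
      using arg_cong[OF zero[OF that], of "\<lambda>A. A $ i $ j"] by simp
    \<comment> \<open>Two parameters suffice: subtracting twice the first equation from the second
      eliminates \<open>H\<close>.\<close>
    from this[of "2*C"] this[of "4*C"] C(1)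
    have "2 * (2*C) * H $ i $ j + (2*C)\<^sup>2 * K $ i $ j = 0"
      "2 * (4*C) * H $ i $ j + (4*C)\<^sup>2 * K $ i $ j = 0"
      by auto
    then have "8 * (C * C * K $ i $ j) = 0" unfolding power2_eq_square by algebra
    with C(1) show ?thesis by simp
  qed
  then show "K = 0" by (simp add: vec_eq_iff)
qed

section \<open>Symmetry of second derivatives\<close>

text \<open>The mean value theorem is applied twice: along \<open>v\<close> to the difference of
  \<open>f\<close> over the step \<open>h *\<^sub>R w\<close>, then along \<open>w\<close> to
  \<open>fv\<close>. The bound on \<open>h\<close> keeps the whole parallelogram inside the
  ball.\<close>

lemma second_difference_mean_value:
  fixes f :: "'b::real_normed_vector \<Rightarrow> real"
  assumes f: "\<And>y. y \<in> ball x \<delta> \<Longrightarrow> ((\<lambda>s. f (y + s *\<^sub>R v)) has_real_derivative fv y) (at 0)"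
    and fv: "\<And>y. y \<in> ball x \<delta> \<Longrightarrow> ((\<lambda>s. fv (y + s *\<^sub>R w)) has_real_derivative fvw y) (at 0)"
    and h: "h > 0" "h * (norm v + norm w) < \<delta>"
  shows "\<exists>y\<in>ball x \<delta>. f (x + h *\<^sub>R v + h *\<^sub>R w) - f (x + h *\<^sub>R v) - f (x + h *\<^sub>R w) + f x
           = h\<^sup>2 * fvw y"
proof -
  have inball: "x + a *\<^sub>R v + b *\<^sub>R w \<in> ball x \<delta>" if "0 \<le> a" "a \<le> h" "0 \<le> b" "b \<le> h" for a b
  proof -
    have "norm (a *\<^sub>R v + b *\<^sub>R w) \<le> a * norm v + b * norm w"
      using that by (metis norm_triangle_ineq norm_scaleR abs_of_nonneg)
    also have "\<dots> \<le> h * norm v + h * norm w"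
      using that by (intro add_mono mult_right_mono) auto
    also have "\<dots> < \<delta>" using h by (simp add: algebra_simps)
    finally show ?thesis
      using dist_add_cancel[of x 0 "a *\<^sub>R v + b *\<^sub>R w"] by (simp add: add.assoc)
  qed
  \<comment> \<open>The hypotheses give line derivatives only at parameter 0, at every base point;
    moving the base point gives them at parameter \<open>a\<close>.\<close>
  have shift: "((\<lambda>s. g (z + s *\<^sub>R u)) has_real_derivative d) (at a)"
    if "((\<lambda>s. g ((z + a *\<^sub>R u) + s *\<^sub>R u)) has_real_derivative d) (at 0)"
    for g :: "'b \<Rightarrow> real" and z u a d
    using that DERIV_shift[of "\<lambda>s. g (z + s *\<^sub>R u)" d 0 a]
    by (simp add: scaleR_left_distrib add.assoc add.commute[of "a *\<^sub>R u"])
  define \<psi> where "\<psi> a = f (x + h *\<^sub>R w + a *\<^sub>R v) - f (x + a *\<^sub>R v)" for a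
  have "\<exists>a>0. a < h \<and> \<psi> h - \<psi> 0 = (h - 0) * (fv (x + h *\<^sub>R w + a *\<^sub>R v) - fv (x + a *\<^sub>R v))"
    unfolding \<psi>_def
  proof (rule MVT2[OF h(1)], rule DERIV_diff)
    fix a assume a: "0 \<le> a" "a \<le> h"
    have "x + h *\<^sub>R w + a *\<^sub>R v \<in> ball x \<delta>"
      using inball[OF a, of h] h(1) by (simp only: add.assoc add.commute[of "h *\<^sub>R w"])
    then show "((\<lambda>a. f (x + h *\<^sub>R w + a *\<^sub>R v)) has_real_derivative fv (x + h *\<^sub>R w + a *\<^sub>R v)) (at a)"
      by (rule shift[OF f])
    have "x + a *\<^sub>R v \<in> ball x \<delta>"
      using inball[OF a, of 0] h(1) by simp
    then show "((\<lambda>a. f (x + a *\<^sub>R v)) has_real_derivative fv (x + a *\<^sub>R v)) (at a)"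
      by (rule shift[OF f])
  qed
  then obtain a where a: "0 < a" "a < h"
    "\<psi> h - \<psi> 0 = h * (fv (x + h *\<^sub>R w + a *\<^sub>R v) - fv (x + a *\<^sub>R v))" by auto
  have "\<exists>b>0. b < h \<and> fv (x + a *\<^sub>R v + h *\<^sub>R w) - fv (x + a *\<^sub>R v + 0 *\<^sub>R w)
          = (h - 0) * fvw (x + a *\<^sub>R v + b *\<^sub>R w)"
  proof (rule MVT2[OF h(1)])
    fix b assume "0 \<le> b" "b \<le> h"
    then have "x + a *\<^sub>R v + b *\<^sub>R w \<in> ball x \<delta>"
      using inball[of a b] a by simp
    then show "((\<lambda>b. fv (x + a *\<^sub>R v + b *\<^sub>R w)) has_real_derivative
        fvw (x + a *\<^sub>R v + b *\<^sub>R w)) (at b)"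
      by (rule shift[OF fv])
  qed
  then obtain b where b: "0 < b" "b < h"
    "fv (x + a *\<^sub>R v + h *\<^sub>R w) - fv (x + a *\<^sub>R v) = h * fvw (x + a *\<^sub>R v + b *\<^sub>R w)" by auto
  have "\<psi> h - \<psi> 0 = h\<^sup>2 * fvw (x + a *\<^sub>R v + b *\<^sub>R w)"
    using a(3) b(3) by (simp add: ac_simps power2_eq_square)
  moreover have "x + a *\<^sub>R v + b *\<^sub>R w \<in> ball x \<delta>"
    using inball[of a b] a b by simp
  ultimately show ?thesis
    by (intro bexI[of _ "x + a *\<^sub>R v + b *\<^sub>R w"]) (auto simp: \<psi>_def ac_simps)
qed

text \<open>The second difference is symmetric in \<open>v\<close> and \<open>w\<close>, so
  expanding it in both orders yields equal values of \<open>fvw\<close> and \<open>fwv\<close> at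
  two points near \<open>x\<close>. Continuity then excludes different values at
  \<open>x\<close>.\<close>

lemma symmetric_mixed_derivatives:
  fixes f :: "'b::real_normed_vector \<Rightarrow> real"
  assumes U: "open U" "x \<in> U"
    and fv: "\<And>y. y \<in> U \<Longrightarrow> ((\<lambda>s. f (y + s *\<^sub>R v)) has_real_derivative fv y) (at 0)"
    and fw: "\<And>y. y \<in> U \<Longrightarrow> ((\<lambda>s. f (y + s *\<^sub>R w)) has_real_derivative fw y) (at 0)"
    and fvw: "\<And>y. y \<in> U \<Longrightarrow> ((\<lambda>s. fv (y + s *\<^sub>R w)) has_real_derivative fvw y) (at 0)"
    and fwv: "\<And>y. y \<in> U \<Longrightarrow> ((\<lambda>s. fw (y + s *\<^sub>R v)) has_real_derivative fwv y) (at 0)"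
    and cont: "continuous_on U fvw" "continuous_on U fwv"
  shows "fvw x = fwv x"
proof (rule ccontr)
  assume ne: "fvw x \<noteq> fwv x"
  define e where "e = dist (fvw x) (fwv x) / 2"
  have e: "e > 0" using ne by (simp add: e_def)
  obtain d0 where d0: "d0 > 0" "ball x d0 \<subseteq> U"
    using U openE by blast
  obtain d1 where d1: "d1 > 0" "\<And>y. y \<in> U \<Longrightarrow> dist y x < d1 \<Longrightarrow> dist (fvw y) (fvw x) < e"
    using cont(1) U(2) e unfolding continuous_on_iff by metis
  obtain d2 where d2: "d2 > 0" "\<And>y. y \<in> U \<Longrightarrow> dist y x < d2 \<Longrightarrow> dist (fwv y) (fwv x) < e"
    using cont(2) U(2) e unfolding continuous_on_iff by metis
  define \<delta> where "\<delta> = min d0 (min d1 d2)"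
  have \<delta>: "\<delta> > 0" using d0 d1 d2 by (simp add: \<delta>_def)
  have sub: "ball x \<delta> \<subseteq> U" using d0(2) by (auto simp: \<delta>_def)
  \<comment> \<open>The summand 1 keeps the denominator positive when both vectors are 0, and makes
    the size bound strict.\<close>
  define h where "h = \<delta> / (norm v + norm w + 1)"
  have pos: "norm v + norm w + 1 > 0" by (smt (verit) norm_ge_zero)
  have h: "h > 0" "h * (norm v + norm w) < \<delta>"
    using \<delta> pos by (auto simp: h_def field_simps)
  have h': "h * (norm w + norm v) < \<delta>" using h(2) by (simp add: add.commute)
  obtain y where y: "y \<in> ball x \<delta>"
    "f (x + h *\<^sub>R v + h *\<^sub>R w) - f (x + h *\<^sub>R v) - f (x + h *\<^sub>R w) + f x = h\<^sup>2 * fvw y"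
    using second_difference_mean_value[OF fv fvw h] sub by (meson subsetD)
  obtain z where z: "z \<in> ball x \<delta>"
    "f (x + h *\<^sub>R w + h *\<^sub>R v) - f (x + h *\<^sub>R w) - f (x + h *\<^sub>R v) + f x = h\<^sup>2 * fwv z"
    using second_difference_mean_value[OF fw fwv h(1) h'] sub by (meson subsetD)
  have "h\<^sup>2 * fvw y = h\<^sup>2 * fwv z"
    using y(2) z(2) unfolding add.assoc[of x] add.commute[of "h *\<^sub>R w"] by linarith
  then have yz: "fwv z = fvw y" using h by simp
  have "dist (fvw y) (fvw x) < e" "dist (fwv z) (fwv x) < e"
    using d1(2)[of y] d2(2)[of z] y(1) z(1) sub by (auto simp: \<delta>_def dist_commute)
  then have "dist (fvw x) (fwv x) < dist (fvw x) (fwv x)"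
    unfolding yz e_def by (rule dist_triangle_half_r)
  then show False by simp
qed

lemma has_derivative_imp_line_derivative:
  fixes f :: "'b::real_normed_vector \<Rightarrow> real"
  assumes "(f has_derivative f') (at y)"
  shows "((\<lambda>s. f (y + s *\<^sub>R v)) has_real_derivative f' v) (at 0)"
proof -
  have "((\<lambda>s. f (y + s *\<^sub>R v)) has_derivative (\<lambda>s. f' (s *\<^sub>R v))) (at 0)"
    by (rule has_derivative_compose[of "\<lambda>s. y + s *\<^sub>R v" "\<lambda>s. s *\<^sub>R v" 0 UNIV f f'])
       (use assms in \<open>auto intro!: derivative_eq_intros\<close>)
  moreover have "f' (s *\<^sub>R v) = f' v * s" for s
    using has_derivative_linear[OF assms] by (simp add: linear_cmul)
  ultimately show ?thesis by (simp add: has_field_derivative_def mult_commute_abs fun_eq_iff)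
qed

lemma ck_2_symmetric_second_derivative:
  fixes f :: "'b::real_normed_vector \<Rightarrow> 'c::real_inner"
  assumes f: "ck_on 2 U f" and U: "open U" "x \<in> U"
  shows "frechet_derivative (\<lambda>y. frechet_derivative f (at y) v) (at x) w =
         frechet_derivative (\<lambda>y. frechet_derivative f (at y) w) (at x) v"
proof -
  define f2 where "f2 v w y = frechet_derivative (\<lambda>y. frechet_derivative f (at y) v) (at y) w" for v w y
  have d1: "(f has_derivative frechet_derivative f (at y)) (at y)" if "y \<in> U" for y
    using f that by (simp add: numeral_2_eq_2 frechet_derivative_works)
  have d2: "((\<lambda>y. frechet_derivative f (at y) v) has_derivative (\<lambda>w. f2 v w y)) (at y)"
    if "y \<in> U" for y v
    using f that by (simp add: numeral_2_eq_2 frechet_derivative_works f2_def)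
  have cont: "continuous_on U (f2 v w)" for v w
    using f by (simp add: numeral_2_eq_2 f2_def)
  \<comment> \<open>Pairing with a fixed vector reduces the claim to real-valued functions, for
    which the mean value argument is available.\<close>
  have "f2 v w x \<bullet> e = f2 w v x \<bullet> e" for e
  proof (rule symmetric_mixed_derivatives[OF U, where f = "\<lambda>y. f y \<bullet> e"
        and fvw = "\<lambda>y. f2 v w y \<bullet> e" and fwv = "\<lambda>y. f2 w v y \<bullet> e"])
    fix y u assume y: "y \<in> U"
    have "((\<lambda>y. f y \<bullet> e) has_derivative (\<lambda>u. frechet_derivative f (at y) u \<bullet> e)) (at y)"
      by (intro has_derivative_inner_left d1 y)
    then show "((\<lambda>s. f (y + s *\<^sub>R v) \<bullet> e) has_real_derivative frechet_derivative f (at y) v \<bullet> e) (at 0)"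
      "((\<lambda>s. f (y + s *\<^sub>R w) \<bullet> e) has_real_derivative frechet_derivative f (at y) w \<bullet> e) (at 0)"
      by (rule has_derivative_imp_line_derivative)+
    have "((\<lambda>y. frechet_derivative f (at y) v \<bullet> e) has_derivative (\<lambda>w. f2 v w y \<bullet> e)) (at y)"
      for v by (intro has_derivative_inner_left d2 y)
    then show "((\<lambda>s. frechet_derivative f (at (y + s *\<^sub>R w)) v \<bullet> e) has_real_derivative f2 v w y \<bullet> e) (at 0)"
      "((\<lambda>s. frechet_derivative f (at (y + s *\<^sub>R v)) w \<bullet> e) has_real_derivative f2 w v y \<bullet> e) (at 0)"
      by (rule has_derivative_imp_line_derivative)+
  next
    show "continuous_on U (\<lambda>y. f2 v w y \<bullet> e)" "continuous_on U (\<lambda>y. f2 w v y \<bullet> e)"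
      by (intro continuous_on_inner cont continuous_on_const)+
  qed
  then show ?thesis unfolding f2_def by (metis vector_eq_rdot)
qed

section \<open>Families of linear immersions\<close>

lemma orthonormal_basis_of_expand:
  assumes "orthonormal_basis_of T B" "z \<in> T"
  shows "(\<Sum>b\<in>B. (z \<bullet> b) *\<^sub>R b) = z"
  using assms unfolding orthonormal_basis_of_def
  by (metis inner_commute orthonormal_basis_expand pairwise_orthogonal_imp_finite)

lemma matrix_inner_symmetricI:
  fixes A :: "real^'n^'n"
  assumes "\<And>x y. x \<bullet> (A *v y) = y \<bullet> (A *v x)"
  shows "transpose A = A"
proof -
  have "A $ i $ j = axis i 1 \<bullet> (A *v axis j 1)" for i j
    by (simp add: inner_axis' matrix_vector_mult_basis column_def)
  then show ?thesis by (simp add: vec_eq_iff transpose_def assms[of "axis _ 1" "axis _ 1"])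
qed

text \<open>\<open>D\<close> and \<open>E\<close> are the differentials of a parametrization and of the normal field at a point.
  The forms that \<open>D\<close> carries over to its range are extended to \<open>\<real>\<^sup>n\<close> by the projection \<open>D \<circ> \<pi>\<close>, and
  the metric by the identity on the normal space. This allows determinants of \<open>n \<times> n\<close> matrices to be
  used although \<open>'b\<close> has no fixed basis.\<close>

lemma linear_family_trace_zero:
  fixes D E :: "'b::real_normed_vector \<Rightarrow> real^'n"
  defines "F \<equiv> \<lambda>t v. D v + t *\<^sub>R E v"
  assumes D: "linear D" and E: "linear E"
    and sym: "\<And>v w. D v \<bullet> E w = D w \<bullet> E v"
    and "\<epsilon> > 0"
    and inj: "\<And>t. \<bar>t\<bar> < \<epsilon> \<Longrightarrow> inj (F t)"
    and tr: "\<And>t. \<bar>t\<bar> < \<epsilon> \<Longrightarrow>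
      \<exists>B. orthonormal_basis_of (range (F t)) B \<and> (\<Sum>b\<in>B. b \<bullet> E (inv (F t) b)) = 0"
  shows "E v = 0"
proof -
  note [simp] = linear_add[OF D] linear_add[OF E] linear_scale[OF D] linear_scale[OF E]
    linear_0[OF D] linear_0[OF E]
  have F: "linear (F t)" for t
    unfolding F_def by (intro linearI) (simp_all add: algebra_simps)
  have inj_D: "inj D" using inj[of 0] \<open>\<epsilon> > 0\<close> by (simp add: F_def)
  obtain B0 where B0: "orthonormal_basis_of (range D) B0"
    using orthonormal_basis_subspace[OF linear_subspace_image[OF D subspace_UNIV]]
    unfolding orthonormal_basis_of_def by metis
  \<comment> \<open>A linear left inverse of \<open>D\<close> for which
    \<open>D \<circ> \<pi>\<close> is the orthogonal projection onto the range of
    \<open>D\<close>.\<close>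
  define \<pi> where "\<pi> z = (\<Sum>b\<in>B0. (z \<bullet> b) *\<^sub>R inv D b)" for z
  have \<pi>: "linear \<pi>"
    unfolding \<pi>_def by (intro linearI)
      (simp_all add: inner_left_distrib scaleR_left_distrib sum.distrib scaleR_sum_right)
  have "span B0 = range D" using B0 by (simp add: orthonormal_basis_of_def)
  then have DinvB0: "D (inv D b) = b" if "b \<in> B0" for b
    using that by (metis f_inv_into_f span_base)
  have D\<pi>: "D (\<pi> z) = (\<Sum>b\<in>B0. (z \<bullet> b) *\<^sub>R b)" for z
    by (simp add: \<pi>_def linear_sum[OF D] DinvB0)
  have \<pi>D: "\<pi> (D v) = v" for v
  proof -
    have "D (\<pi> (D v)) = D v"
      using orthonormal_basis_of_expand[OF B0, of "D v"] by (simp add: D\<pi>)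
    then show ?thesis by (rule injD[OF inj_D])
  qed
  have proj: "D (\<pi> z) \<bullet> D v = z \<bullet> D v" for z v
  proof -
    have "D (\<pi> z) \<bullet> D v = (\<Sum>b\<in>B0. (z \<bullet> b) * (D v \<bullet> b))"
      by (simp add: D\<pi> inner_sum_left inner_commute[of _ "D v"] inner_sum_right)
    also have "\<dots> = z \<bullet> (\<Sum>b\<in>B0. (D v \<bullet> b) *\<^sub>R b)"
      by (simp add: inner_sum_right mult.commute)
    also have "\<dots> = z \<bullet> D v"
      using orthonormal_basis_of_expand[OF B0, of "D v"] by simp
    finally show ?thesis .
  qed
  define e where "e z = E (\<pi> z)" for z
  have e: "linear e" unfolding e_def
    using linear_compose[OF \<pi> E] by (simp add: o_def)
  \<comment> \<open>\<open>H\<close> and \<open>K\<close> represent the forms D(\<pi> x) . E(\<pi>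
    y) and E(\<pi> x) . E(\<pi> y), so that \<open>G t\<close> is the metric pulled back by
    \<open>F t \<circ> \<pi>\<close>, plus the inner product of the components normal to the range
    of \<open>D\<close>.\<close>
  define H where "H = matrix (\<lambda>z. D (\<pi> (e z)))"
  define K where "K = matrix (\<lambda>z. adjoint e (e z))"
  have Hv: "H *v z = D (\<pi> (e z))" for z
    using linear_compose[OF linear_compose[OF e \<pi>] D] by (simp add: H_def o_def matrix_works)
  have Kv: "K *v z = adjoint e (e z)" for z
    using linear_compose[OF e adjoint_linear[OF e]] by (simp add: K_def o_def matrix_works)
  have xH: "x \<bullet> (H *v y) = D (\<pi> x) \<bullet> E (\<pi> y)" for x y
    by (metis Hv e_def inner_commute proj)
  have xK: "x \<bullet> (K *v y) = E (\<pi> x) \<bullet> E (\<pi> y)" for x y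
    by (simp add: Kv adjoint_works[OF e] e_def)
  define G where "G t = mat 1 + (2*t) *\<^sub>R H + t\<^sup>2 *\<^sub>R K" for t :: real
  have xG: "x \<bullet> (G t *v y) = x \<bullet> y + 2 * t * (D (\<pi> x) \<bullet> E (\<pi> y)) + t\<^sup>2 * (E (\<pi> x) \<bullet> E (\<pi> y))" for t x y
    by (simp add: G_def matrix_vector_add_scaleR inner_right_distrib xH xK)
  have "K = 0"
  proof (rule quadratic_pencil_trace_zero[OF _ _ _ \<open>\<epsilon> > 0\<close>, of H K, folded G_def])
    show "transpose H = H" by (rule matrix_inner_symmetricI) (simp add: xH sym)
    show "transpose K = K" by (rule matrix_inner_symmetricI) (simp add: xK inner_commute)
    \<comment> \<open>\<open>H *v z\<close> is the orthogonal projection of \<open>e z\<close>,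
      hence no longer than it.\<close>
    show "(H *v z) \<bullet> (H *v z) \<le> z \<bullet> (K *v z)" for z
    proof -
      have "0 \<le> (e z - D (\<pi> (e z))) \<bullet> (e z - D (\<pi> (e z)))" by simp
      also have "\<dots> = e z \<bullet> e z - D (\<pi> (e z)) \<bullet> D (\<pi> (e z))"
        by (simp add: inner_diff_left inner_diff_right proj inner_commute[of "D _" "e z"])
      finally show ?thesis by (simp add: Hv xK e_def)
    qed
  next
    fix t z assume t: "\<bar>t\<bar> < \<epsilon>" and Gz: "G t *v z = 0"
    \<comment> \<open>The form of \<open>G t\<close> splits into a tangential and a normal square,
      so a kernel vector makes both vanish.\<close>
    have "(F t (\<pi> z)) \<bullet> (F t (\<pi> z)) + (z - D (\<pi> z)) \<bullet> (z - D (\<pi> z)) = z \<bullet> (G t *v z)"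
      unfolding xG by (simp add: F_def inner_add_left inner_add_right inner_diff_left inner_diff_right
          proj inner_commute[of "D _" z] inner_commute[of "E _" "D _"] power2_eq_square distrib_left)
    then have "F t (\<pi> z) \<bullet> F t (\<pi> z) = 0" "(z - D (\<pi> z)) \<bullet> (z - D (\<pi> z)) = 0"
      using inner_ge_zero[of "F t (\<pi> z)"] inner_ge_zero[of "z - D (\<pi> z)"]
      unfolding Gz inner_zero_right by linarith+
    then have "F t (\<pi> z) = 0" "z = D (\<pi> z)" by simp_all
    then have "\<pi> z = 0" using inj[OF t] linear_injective_0[OF F] by blast
    then show "z = 0" using \<open>z = D (\<pi> z)\<close> by simp
  next
    fix t R assume t: "\<bar>t\<bar> < \<epsilon>" and R: "R ** G t = mat 1"
    obtain B where B: "orthonormal_basis_of (range (F t)) B"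
      and tr0: "(\<Sum>b\<in>B. b \<bullet> E (inv (F t) b)) = 0"
      using tr[OF t] by blast
    define u where "u = inv (F t)"
    have Fu: "F t (u b) = b" if "b \<in> B" for b
      using that B unfolding orthonormal_basis_of_def u_def by (metis f_inv_into_f span_base)
    have GR: "G t ** R = mat 1" by (rule matrix_left_right_inverse[THEN iffD1, OF R])
    \<comment> \<open>The vectors \<open>u b\<close> are orthonormal for the metric pulled back by
      \<open>F t\<close>. Pairing \<open>G t *v z\<close> with \<open>D (u b)\<close> gives
      F_t(\<pi> z) . b, the coordinate of \<pi> z along \<open>u b\<close>.\<close>
    have \<pi>R: "\<pi> (R *v y) = (\<Sum>b\<in>B. (y \<bullet> D (u b)) *\<^sub>R u b)" for y
    proof -
      define z where "z = R *v y"
      have y: "y = G t *v z" by (simp add: z_def matrix_vector_mul_assoc GR)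
      have "y \<bullet> D (u b) = F t (\<pi> z) \<bullet> b" if "b \<in> B" for b
      proof -
        have sym_E: "E (\<pi> z) \<bullet> D (u b) = D (\<pi> z) \<bullet> E (u b)"
          unfolding inner_commute[of "E _"] by (rule sym)
        have "y \<bullet> D (u b) = D (u b) \<bullet> (G t *v z)" unfolding y by (rule inner_commute)
        also have "\<dots> = F t (\<pi> z) \<bullet> F t (u b)"
          unfolding xG \<pi>D
          by (simp add: F_def inner_add_left inner_add_right sym[of "u b" "\<pi> z"] sym_E proj
              inner_commute[of _ z] inner_commute[of "E (u b)"] power2_eq_square distrib_left)
        finally show ?thesis using Fu[OF that] by simp
      qed
      then have "F t (\<Sum>b\<in>B. (y \<bullet> D (u b)) *\<^sub>R u b) = (\<Sum>b\<in>B. (F t (\<pi> z) \<bullet> b) *\<^sub>R b)"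
        by (simp add: linear_sum[OF F] linear_scale[OF F] Fu)
      also have "\<dots> = F t (\<pi> z)"
        by (rule orthonormal_basis_of_expand[OF B]) simp
      finally show ?thesis unfolding z_def[symmetric]
        by (rule injD[OF inj[OF t], symmetric])
    qed
    \<comment> \<open>The trace over the standard basis becomes a sum over \<open>B\<close>: expand
      \<pi> (R e_i) in the vectors \<open>u b\<close>, swap the sums, and reassemble
      \<open>D (u b)\<close> from its coordinates, which \<open>F t \<circ> \<pi>\<close> sends to
      \<open>b\<close>.\<close>
    have "trace (R ** (H + t *\<^sub>R K)) = trace ((H + t *\<^sub>R K) ** R)"
      by (rule trace_mul_sym)
    also have "\<dots> = (\<Sum>i\<in>UNIV. F t (\<pi> (axis i 1)) \<bullet> E (\<pi> (R *v axis i 1)))"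
      unfolding trace_eq_sum_inner
      by (simp add: matrix_vector_mul_assoc[symmetric] matrix_vector_add_scaleR inner_right_distrib
          xH xK F_def inner_add_left)
    also have "\<dots> = (\<Sum>i\<in>UNIV. \<Sum>b\<in>B. (D (u b) $ i) * (F t (\<pi> (axis i 1)) \<bullet> E (u b)))"
      by (simp add: \<pi>R linear_sum[OF E] inner_sum_right inner_axis')
    also have "\<dots> = (\<Sum>b\<in>B. \<Sum>i\<in>UNIV. (D (u b) $ i) * (F t (\<pi> (axis i 1)) \<bullet> E (u b)))"
      by (rule sum.swap)
    also have "\<dots> = (\<Sum>b\<in>B. b \<bullet> E (u b))"
    proof (rule sum.cong[OF refl])
      fix b assume b: "b \<in> B"
      have L: "linear (\<lambda>x. F t (\<pi> x) \<bullet> E (u b))"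
        by (intro linearI) (simp_all add: linear_add[OF \<pi>] linear_add[OF F] linear_scale[OF \<pi>]
            linear_scale[OF F] inner_left_distrib)
      have "(\<Sum>i\<in>UNIV. (D (u b) $ i) * (F t (\<pi> (axis i 1)) \<bullet> E (u b)))
          = F t (\<pi> (\<Sum>i\<in>UNIV. (D (u b) $ i) *\<^sub>R axis i 1)) \<bullet> E (u b)"
        by (simp add: linear_sum[OF L] linear_scale[OF L])
      also have "(\<Sum>i\<in>UNIV. (D (u b) $ i) *\<^sub>R axis i 1) = D (u b)"
        using basis_expansion[of "D (u b)"] by (simp add: scalar_mult_eq_scaleR)
      finally show "(\<Sum>i\<in>UNIV. (D (u b) $ i) * (F t (\<pi> (axis i 1)) \<bullet> E (u b))) = b \<bullet> E (u b)"
        by (simp add: \<pi>D Fu[OF b])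
    qed
    finally show "trace (R ** (H + t *\<^sub>R K)) = 0" using tr0 by (simp add: u_def)
  qed
  then have "E v \<bullet> E v = 0"
    using xK[of "D v" "D v"] by (simp add: \<pi>D)
  then show ?thesis by simp
qed

section \<open>Families of minimal immersions\<close>

text \<open>Orthogonal decomposition gives existence and uniqueness, so the definite description in
  \<open>tangential_part\<close> denotes the projection.\<close>

lemma tangential_part_in:
  assumes "subspace T"
  shows "tangential_part T w \<in> T"
proof -
  obtain y z where yz: "y \<in> span T" "\<And>u. u \<in> span T \<Longrightarrow> orthogonal z u" "w = y + z"
    using orthogonal_subspace_decomp_exists[of T w] by blast
  have [simp]: "span T = T" using assms by (simp add: span_eq_iff)
  have "\<exists>!y. y \<in> T \<and> (\<forall>u\<in>T. orthogonal (w - y) u)"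
  proof (rule ex1I[of _ y])
    show "y \<in> T \<and> (\<forall>u\<in>T. orthogonal (w - y) u)" using yz by simp
    fix y' assume y': "y' \<in> T \<and> (\<forall>u\<in>T. orthogonal (w - y') u)"
    then have d: "y' - y \<in> T" using yz assms by (simp add: subspace_diff)
    then have "orthogonal (w - y') (y' - y)" "orthogonal (w - y) (y' - y)"
      using y' yz by simp_all
    then have "(y' - y) \<bullet> (y' - y) = 0"
      by (simp add: orthogonal_def inner_diff_left inner_diff_right)
    then show "y' = y" by simp
  qed
  from theI'[OF this] show ?thesis unfolding tangential_part_def by blast
qed

lemma inner_normal_part:
  assumes "subspace T" "\<And>z. z \<in> T \<Longrightarrow> a \<bullet> z = 0"
  shows "a \<bullet> normal_part T w = a \<bullet> w"
  using assms(2)[OF tangential_part_in[OF assms(1)]]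
  by (simp add: normal_part_def inner_diff_right)

lemma orthonormal_basis_of_exists:
  assumes "subspace T"
  shows "\<exists>B. orthonormal_basis_of T B"
  using orthonormal_basis_subspace[OF assms] unfolding orthonormal_basis_of_def by metis

lemma derivative_of_constant_inner:
  fixes f g :: "'b::real_normed_vector \<Rightarrow> 'c::real_inner"
  assumes "open U" "x \<in> U" "\<And>y. y \<in> U \<Longrightarrow> f y \<bullet> g y = c"
    and f: "(f has_derivative f') (at x)" and g: "(g has_derivative g') (at x)"
  shows "f x \<bullet> g' v + f' v \<bullet> g x = 0"
proof -
  have "((\<lambda>y. f y \<bullet> g y) has_derivative (\<lambda>v. f x \<bullet> g' v + f' v \<bullet> g x)) (at x)"
    by (rule has_derivative_inner[OF f g])
  moreover have "((\<lambda>y. f y \<bullet> g y) has_derivative (\<lambda>v. 0)) (at x)"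
    by (rule has_derivative_transform_within_open[OF has_derivative_const[of c] assms(1,2)])
       (simp add: assms(3))
  ultimately show ?thesis by (metis has_derivative_unique)
qed

lemma smooth_on_has_derivative:
  assumes "smooth_on U f" "x \<in> U"
  shows "(f has_derivative frechet_derivative f (at x)) (at x)"
proof -
  have "ck_on (Suc 0) U f" using assms(1) unfolding smooth_on_def by blast
  then show ?thesis using assms(2) by (simp add: frechet_derivative_works)
qed

lemma smooth_on_has_second_derivative:
  assumes "smooth_on U f" "x \<in> U"
  shows "((\<lambda>y. frechet_derivative f (at y) w) has_derivative
           frechet_derivative (\<lambda>y. frechet_derivative f (at y) w) (at x)) (at x)"
proof -
  have "ck_on (Suc (Suc 0)) U f" using assms(1) unfolding smooth_on_def by blast
  then show ?thesis using assms(2) by (simp add: frechet_derivative_works)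
qed

text \<open>Turns vanishing mean curvature into the trace condition of the linear lemma. Assumption
  \<open>W\<close> is the Weingarten equation, with \<open>A\<close> for the differential of the
  normal field. The basis is the one chosen inside \<open>mean_curvature\<close>, known only to be
  orthonormal, hence the existential.\<close>

lemma inner_mean_curvature:
  fixes F :: "'b::real_normed_vector \<Rightarrow> real^'n"
  assumes lin: "linear (frechet_derivative F (at x))"
    and inj: "inj (frechet_derivative F (at x))"
    and \<eta>: "\<And>v. \<eta> \<bullet> frechet_derivative F (at x) v = 0"
    and W: "\<And>v w. \<eta> \<bullet> frechet_derivative (\<lambda>y. frechet_derivative F (at y) w) (at x) v
              = - (A v \<bullet> frechet_derivative F (at x) w)"
  shows "\<exists>B. orthonormal_basis_of (range (frechet_derivative F (at x))) B \<and>
           \<eta> \<bullet> mean_curvature F x = - (\<Sum>b\<in>B. b \<bullet> A (inv (frechet_derivative F (at x)) b))"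
proof -
  define dF where "dF = frechet_derivative F (at x)"
  define B where "B = (SOME B. orthonormal_basis_of (range dF) B)"
  have sub: "subspace (range dF)"
    using linear_subspace_image[OF lin subspace_UNIV] by (simp add: dF_def)
  have B: "orthonormal_basis_of (range dF) B"
    unfolding B_def by (rule someI_ex[OF orthonormal_basis_of_exists[OF sub]])
  have "\<eta> \<bullet> second_fundamental_form F x (inv dF b) (inv dF b) = - (b \<bullet> A (inv dF b))" if "b \<in> B" for b
  proof -
    have "b \<in> range dF"
      using B that unfolding orthonormal_basis_of_def by (metis span_base)
    then have "dF (inv dF b) = b" by (rule f_inv_into_f)
    moreover have "\<eta> \<bullet> normal_part (range dF) w = \<eta> \<bullet> w" for w
      by (rule inner_normal_part[OF sub]) (use \<eta> in \<open>auto simp: dF_def\<close>)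
    ultimately show ?thesis
      unfolding second_fundamental_form_def dF_def[symmetric]
      using W[of "inv dF b" "inv dF b"] by (simp add: dF_def inner_commute)
  qed
  then have "\<eta> \<bullet> mean_curvature F x = - (\<Sum>b\<in>B. b \<bullet> A (inv dF b))"
    unfolding mean_curvature_def Let_def dF_def[symmetric] B_def[symmetric]
    by (simp add: inner_sum_right sum_negf)
  with B show ?thesis unfolding dF_def by blast
qed

text \<open>The local form of the theorem, in one parametrization. Differentiating normality and
  constant length reduces it to linear algebra on the differentials at \<open>x\<close>.\<close>

lemma minimal_family_derivative_zero:
  fixes \<phi> \<eta> :: "'b::real_normed_vector \<Rightarrow> real^'n"
  assumes U: "open U" "x \<in> U" and \<phi>: "smooth_on U \<phi>" and \<eta>: "smooth_on U \<eta>"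
    and normal: "\<And>y v. y \<in> U \<Longrightarrow> \<eta> y \<bullet> frechet_derivative \<phi> (at y) v = 0"
    and len: "\<And>y. y \<in> U \<Longrightarrow> norm (\<eta> y) = c"
    and "\<epsilon> > 0"
    and imm: "\<And>t. \<bar>t\<bar> < \<epsilon> \<Longrightarrow> immersion_on U (\<lambda>y. \<phi> y + t *\<^sub>R \<eta> y)"
    and minimal: "\<And>t. \<bar>t\<bar> < \<epsilon> \<Longrightarrow> mean_curvature (\<lambda>y. \<phi> y + t *\<^sub>R \<eta> y) x = 0"
  shows "frechet_derivative \<eta> (at x) v = 0"
proof -
  define D where "D y = frechet_derivative \<phi> (at y)" for y
  define E where "E y = frechet_derivative \<eta> (at y)" for y
  define F where "F t = (\<lambda>y. \<phi> y + t *\<^sub>R \<eta> y)" for t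
  have D: "(\<phi> has_derivative D y) (at y)" and E: "(\<eta> has_derivative E y) (at y)" if "y \<in> U" for y
    using that smooth_on_has_derivative \<phi> \<eta> by (auto simp: D_def E_def)
  have dF: "frechet_derivative (F t) (at y) = (\<lambda>v. D y v + t *\<^sub>R E y v)" if "y \<in> U" for t y
    unfolding F_def
    by (rule frechet_derivative_at[symmetric]) (intro derivative_intros D E that)
  \<comment> \<open>Constant length makes \<eta> orthogonal to its own derivative, which keeps it
    normal to every member of the family.\<close>
  have "\<eta> y \<bullet> E y v = 0" if "y \<in> U" for y v
    using derivative_of_constant_inner[OF U(1) that _ E[OF that] E[OF that], of "c\<^sup>2" v] len
    by (simp add: dot_square_norm inner_commute)
  then have \<eta>_dF: "\<eta> y \<bullet> frechet_derivative (F t) (at y) v = 0" if "y \<in> U" for t y v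
    using that normal by (simp add: dF D_def inner_add_right)
  have weingarten: "\<eta> x \<bullet> frechet_derivative (\<lambda>y. frechet_derivative (F t) (at y) w) (at x) v
      = - (E x v \<bullet> frechet_derivative (F t) (at x) w)" if t: "\<bar>t\<bar> < \<epsilon>" for t v w
  proof -
    have "smooth_on U (F t)" using imm[OF t] by (simp add: immersion_on_def F_def)
    from derivative_of_constant_inner[OF U \<eta>_dF E[OF U(2)]
        smooth_on_has_second_derivative[OF this U(2)]]
    show ?thesis by (simp add: add_eq_0_iff)
  qed
  have "E x v = 0"
  proof (rule linear_family_trace_zero[OF _ _ _ \<open>\<epsilon> > 0\<close>, of "D x" "E x"])
    show "linear (D x)" "linear (E x)"
      using D[OF U(2)] E[OF U(2)] by (auto dest: has_derivative_linear)
    \<comment> \<open>By the Weingarten equation at t = 0, both sides are minus the pairing of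
      \<eta> with a second derivative of \<phi>, which is symmetric.\<close>
    show "D x v \<bullet> E x w = D x w \<bullet> E x v" for v w
    proof -
      have "ck_on 2 U \<phi>" using \<phi> by (simp add: smooth_on_def)
      from ck_2_symmetric_second_derivative[OF this U]
      have "frechet_derivative (\<lambda>y. D y v) (at x) w = frechet_derivative (\<lambda>y. D y w) (at x) v"
        by (simp add: D_def)
      then show ?thesis
        using weingarten[of 0 v w] weingarten[of 0 w v] \<open>\<epsilon> > 0\<close>
        by (simp add: F_def D_def[symmetric] inner_commute)
    qed
    fix t assume t: "\<bar>t\<bar> < \<epsilon>"
    have inj: "inj (frechet_derivative (F t) (at x))"
      using imm[OF t] U(2) by (auto simp: immersion_on_def F_def)
    then show "inj (\<lambda>v. D x v + t *\<^sub>R E x v)" by (simp add: dF U(2))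
    have "linear (frechet_derivative (F t) (at x))"
      using smooth_on_has_derivative imm[OF t] U(2) has_derivative_linear
      unfolding immersion_on_def F_def by blast
    from inner_mean_curvature[OF this inj \<eta>_dF[OF U(2)] weingarten[OF t]]
    show "\<exists>B. orthonormal_basis_of (range (\<lambda>v. D x v + t *\<^sub>R E x v)) B \<and>
        (\<Sum>b\<in>B. b \<bullet> E x (inv (\<lambda>v. D x v + t *\<^sub>R E x v) b)) = 0"
      using minimal[OF t] by (simp add: dF U(2) F_def[symmetric])
  qed
  then show ?thesis by (simp add: E_def)
qed

section \<open>From local parametrizations to the submanifold\<close>

theorem corollary1p3:
  fixes M :: "(real^'n) set"
    and \<A> :: "('b::real_normed_vector set \<times> ('b \<Rightarrow> real^'n)) set"
    and \<xi> :: "real^'n \<Rightarrow> real^'n"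
  assumes "is_submanifold M \<A>"
    and "normal_field M \<A> \<xi>"
    and "\<exists>c. \<forall>p\<in>M. norm (\<xi> p) = c"
    and "\<exists>\<epsilon>>0. \<forall>t. \<bar>t\<bar> < \<epsilon> \<longrightarrow> minimal_immersed_submanifold \<A> (\<lambda>p. p + t *\<^sub>R \<xi> p)"
  shows "(\<forall>p\<in>M. \<forall>X\<in>tangent_space \<A> p. dir_deriv \<A> \<xi> p X = 0) \<and>
    (\<forall>p\<in>M. \<forall>X\<in>tangent_space \<A> p. normal_connection \<A> \<xi> p X = 0) \<and>
    (\<forall>p\<in>M. \<forall>X\<in>tangent_space \<A> p. shape_operator \<A> \<xi> p X = 0)"
proof -
  obtain c where c: "\<And>p. p \<in> M \<Longrightarrow> norm (\<xi> p) = c" using assms(3) by blast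
  obtain \<epsilon> where \<epsilon>: "\<epsilon> > 0"
    "\<And>t. \<bar>t\<bar> < \<epsilon> \<Longrightarrow> minimal_immersed_submanifold \<A> (\<lambda>p. p + t *\<^sub>R \<xi> p)"
    using assms(4) by blast
  have in_M: "\<phi> y \<in> M" if "(U, \<phi>) \<in> \<A>" "y \<in> U" for U \<phi> y
    using assms(1) that unfolding is_submanifold_def by blast
  have local: "frechet_derivative (\<xi> \<circ> \<phi>) (at x) v = 0"
    if A: "(U, \<phi>) \<in> \<A>" and x: "x \<in> U" for U \<phi> x v
  proof (rule minimal_family_derivative_zero[OF _ x _ _ _ _ \<epsilon>(1)])
    show "open U" "smooth_on U \<phi>"
      using assms(1) A unfolding is_submanifold_def immersion_on_def by auto
    show "smooth_on U (\<xi> \<circ> \<phi>)"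
      using assms(2) A unfolding normal_field_def smooth_map_def by auto
    show "(\<xi> \<circ> \<phi>) y \<bullet> frechet_derivative \<phi> (at y) v = 0" if "y \<in> U" for y v
    proof -
      have "frechet_derivative \<phi> (at y) v \<in> tangent_space \<A> (\<phi> y)"
        using A that unfolding tangent_space_def by blast
      then show ?thesis
        using assms(2) in_M[OF A that] unfolding normal_field_def orthogonal_def by simp
    qed
    show "norm ((\<xi> \<circ> \<phi>) y) = c" if "y \<in> U" for y
      using c in_M[OF A that] by simp
    fix t assume t: "\<bar>t\<bar> < \<epsilon>"
    show "immersion_on U (\<lambda>y. \<phi> y + t *\<^sub>R (\<xi> \<circ> \<phi>) y)"
      "mean_curvature (\<lambda>y. \<phi> y + t *\<^sub>R (\<xi> \<circ> \<phi>) y) x = 0"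
      using \<epsilon>(2)[OF t] A x unfolding minimal_immersed_submanifold_def by (auto simp: o_def)
  qed
  \<comment> \<open>Every candidate in the definite description is 0 by \<open>local\<close>, which
    settles uniqueness at once; tangency of \<open>X\<close> supplies a candidate.\<close>
  have deriv: "dir_deriv \<A> \<xi> p X = 0" if X: "X \<in> tangent_space \<A> p" for p X
    unfolding dir_deriv_def
  proof (rule the_equality)
    obtain U \<phi> x v where *: "(U, \<phi>) \<in> \<A>" "x \<in> U" "\<phi> x = p" "X = frechet_derivative \<phi> (at x) v"
      using X unfolding tangent_space_def by blast
    then show "\<exists>(U, \<phi>)\<in>\<A>. \<exists>x\<in>U. \<exists>v. \<phi> x = p \<and> frechet_derivative \<phi> (at x) v = X \<and>
        0 = frechet_derivative (\<xi> \<circ> \<phi>) (at x) v"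
      using local[OF *(1,2)] by (intro bexI[OF _ *(1)]) auto
  next
    fix d
    assume "\<exists>(U, \<phi>)\<in>\<A>. \<exists>x\<in>U. \<exists>v. \<phi> x = p \<and> frechet_derivative \<phi> (at x) v = X \<and>
        d = frechet_derivative (\<xi> \<circ> \<phi>) (at x) v"
    then show "d = 0" using local by auto
  qed
  \<comment> \<open>Uniqueness comes from testing orthogonality of -y against \<open>y\<close>
    itself, so it is enough to know that 0 is a tangent vector.\<close>
  have "tangential_part (tangent_space \<A> p) 0 = 0" if p: "p \<in> M" for p
    unfolding tangential_part_def
  proof (rule the_equality)
    obtain U \<phi> x where *: "(U, \<phi>) \<in> \<A>" "x \<in> U" "\<phi> x = p"
      using assms(1) p unfolding is_submanifold_def by blast
    then have "smooth_on U \<phi>"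
      using assms(1) unfolding is_submanifold_def immersion_on_def by auto
    then have "frechet_derivative \<phi> (at x) 0 = 0"
      using smooth_on_has_derivative *(2) has_derivative_linear linear_0 by blast
    then have "0 \<in> tangent_space \<A> p"
      using * unfolding tangent_space_def by (auto intro!: bexI[OF _ *(1)] bexI[OF _ *(2)] range_eqI[of _ _ 0])
    then show "0 \<in> tangent_space \<A> p \<and> (\<forall>z\<in>tangent_space \<A> p. orthogonal (0 - 0) z)"
      by (simp add: orthogonal_def)
  next
    fix y assume "y \<in> tangent_space \<A> p \<and> (\<forall>z\<in>tangent_space \<A> p. orthogonal (0 - y) z)"
    then have "orthogonal (0 - y) y" by blast
    then show "y = 0" by (simp add: orthogonal_def)
  qed
  with deriv show ?thesis
    by (simp add: normal_connection_def shape_operator_def normal_part_def)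
qed

end
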